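(* Let $(\mathcal{M},\mathcal{F})$ be a complex foliation and let $f,h$ be smooth functions on $\mathcal{M}$. If $h$ does not vanish anywhere on $\mathcal{M}$, then the cohomologies $H^{\bullet,\bullet}_f(\mathcal{F})$ and $H^{\bullet,\bullet}_{fh}(\mathcal{F})$ are isomorphic, i.e. $H^{p,q}_f(\mathcal{F})\cong H^{p,q}_{fh}(\mathcal{F})$ as complex vector spaces for all $p,q$.
   Context: Complex foliation: $\mathcal{M}$ is a smooth manifold of dimension $2m+n$ with a foliation $\mathcal{F}$ of codimension $n$, defined by an open cover $\{U_i\}_{i\in I}$ of $\mathcal{M}$ and diffeomorphisms $\phi_i:\Omega_i\times\mathcal{O}_i\to U_i$ ($\Omega_i$ an open polydisc in $\mathbb{C}^m$, $\mathcal{O}_i$ an open ball in $\mathbb{R}^n$) such that, whenever $U_i\cap U_j\neq\emptyset$, the coordinate change $\phi_j^{-1}\circ\phi_i$ has the form $(z',x')=(\phi_{ij}^1(z,x),\phi_{ij}^2(x))$ with $\phi_{ij}^1(z,x)$ holomorphic in $z$ for fixed $x$. The leaves, locally given by $x=$ const, are complex manifolds of dimension $m$. The coordinates $(z,x)=(z^1,\ldots,z^m,x^1,\ldots,x^n)$ on $U_i$ given by $\phi_i^{-1}:U_i\to\Omega_i\times\mathcal{O}_i$ are called adapted. Foliated forms: $\Omega^{p,q}(\mathcal{F})$ is the space of foliated (leafwise) differential forms of type $(p,q)$, written in adapted coordinates as $\varphi=\sum\varphi_{A_p\overline{B}_q}(z,x)\,dz^{A_p}\wedge d\overline{z}^{B_q}$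 with smooth complex-valued coefficients, where $dz^a,d\overline{z}^a$ are regarded as forms along the leaves (sections of the exterior algebra of the dual of $T\mathcal{F}\otimes\mathbb{C}$). It is $0$ unless $0\le p,q\le m$. The operator $\overline{\partial}_{\mathcal{F}}:\Omega^{p,q}(\mathcal{F})\to\Omega^{p,q+1}(\mathcal{F})$ is $\overline{\partial}_{\mathcal{F}}\varphi=\sum_{a=1}^m\sum\frac{\partial\varphi_{A_p\overline{B}_q}}{\partial\overline{z}^a}\,d\overline{z}^a\wedge dz^{A_p}\wedge d\overline{z}^{B_q}$. Smooth functions on $\mathcal{M}$ may be taken complex-valued. For a smooth function $f$ on $\mathcal{M}$, define $\overline{\partial}_{\mathcal{F},f}:\Omega^{p,q}(\mathcal{F})\to\Omega^{p,q+1}(\mathcal{F})$ by $\overline{\partial}_{\mathcal{F},f}\varphi=f\,\overline{\partial}_{\mathcal{F}}\varphi-(p+q)\,\overline{\partial}_{\mathcal{F}}f\wedge\varphi$. It satisfies $\overline{\partial}_{\mathcal{F},f}^2=0$. For fixed $p$, $H^{p,q}_f(\mathcal{F})$ denotes the degree-$q$ cohomology of the complex $0\to\Omega^{p,0}(\mathcal{F})\to\Omega^{p,1}(\mathcal{F})\to\cdots\to\Omega^{p,m}(\mathcal{F})\to0$ with differential $\overline{\partial}_{\mathcal{F},f}$. *)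

theory Defs
  imports "HOL-Analysis.Analysis" "HOL-Algebra.AbelCoset" "HOL-Algebra.Module"
begin

section \<open>Smooth functions on open subsets of C^m x R^n\<close>

text \<open>
  Points of C^m x R^n are pairs of sequences vanishing from index m, respectively n, on.
  The dimensions are ordinary natural numbers, so that 0 is a legal value of both.
  The subspace topology inherited from the product topology is the Euclidean one.
\<close>

type_synonym point = "(nat \<Rightarrow> complex) \<times> (nat \<Rightarrow> real)"

definition model_space :: "nat \<Rightarrow> nat \<Rightarrow> point set" where
  "model_space m n = {(z, x). (\<forall>k\<ge>m. z k = 0) \<and> (\<forall>l\<ge>n. x l = 0)}"

definition polydisc :: "nat \<Rightarrow> (nat \<Rightarrow> complex) \<Rightarrow> (nat \<Rightarrow> real) \<Rightarrow> (nat \<Rightarrow> complex) set" where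
  "polydisc m c r = {z. (\<forall>k<m. dist (z k) (c k) < r k) \<and> (\<forall>k\<ge>m. z k = 0)}"

definition open_ball :: "nat \<Rightarrow> (nat \<Rightarrow> real) \<Rightarrow> real \<Rightarrow> (nat \<Rightarrow> real) set" where
  "open_ball n c r = {x. sqrt (\<Sum>l<n. (x l - c l)\<^sup>2) < r \<and> (\<forall>l\<ge>n. x l = 0)}"

text \<open>The 2m+n real coordinates Re z^k, Im z^k, x^l, and translation along them.\<close>

datatype real_coord = ReZ nat | ImZ nat | Tr nat

definition real_coords :: "nat \<Rightarrow> nat \<Rightarrow> real_coord set" where
  "real_coords m n = ReZ ` {..<m} \<union> ImZ ` {..<m} \<union> Tr ` {..<n}"

fun shift :: "real_coord \<Rightarrow> real \<Rightarrow> point \<Rightarrow> point" where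
  "shift (ReZ k) t (z, x) = (z(k := z k + complex_of_real t), x)"
| "shift (ImZ k) t (z, x) = (z(k := z k + \<i> * complex_of_real t), x)"
| "shift (Tr l) t (z, x) = (z, x(l := x l + t))"

definition partial :: "real_coord \<Rightarrow> (point \<Rightarrow> complex) \<Rightarrow> point \<Rightarrow> complex" where
  "partial c g u = vector_derivative (\<lambda>t. g (shift c t u)) (at 0)"

definition has_partial :: "real_coord \<Rightarrow> (point \<Rightarrow> complex) \<Rightarrow> point \<Rightarrow> bool" where
  "has_partial c g u \<longleftrightarrow> (\<lambda>t. g (shift c t u)) differentiable (at 0)"

text \<open>C^k on a relatively open set W: the partial derivatives up to order k exist and are
  continuous on W.\<close>

primrec C_times :: "nat \<Rightarrow> nat \<Rightarrow> nat \<Rightarrow> point set \<Rightarrow> (point \<Rightarrow> complex) \<Rightarrow> bool" where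
  "C_times 0 m n W g \<longleftrightarrow> continuous_on W g"
| "C_times (Suc k) m n W g \<longleftrightarrow> continuous_on W g \<and>
     (\<forall>c\<in>real_coords m n. (\<forall>u\<in>W. has_partial c g u) \<and> C_times k m n W (partial c g))"

definition smooth_on :: "nat \<Rightarrow> nat \<Rightarrow> point set \<Rightarrow> (point \<Rightarrow> complex) \<Rightarrow> bool" where
  "smooth_on m n W g \<longleftrightarrow> (\<forall>k. C_times k m n W g)"

definition smooth_map_on :: "nat \<Rightarrow> nat \<Rightarrow> point set \<Rightarrow> (point \<Rightarrow> point) \<Rightarrow> bool" where
  "smooth_map_on m n W g \<longleftrightarrow>
     (\<forall>k<m. smooth_on m n W (\<lambda>u. fst (g u) k)) \<and>
     (\<forall>l<n. smooth_on m n W (\<lambda>u. complex_of_real (snd (g u) l)))"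

definition wirtinger_bar :: "nat \<Rightarrow> (point \<Rightarrow> complex) \<Rightarrow> point \<Rightarrow> complex" where
  "wirtinger_bar a g u = (partial (ReZ a) g u + \<i> * partial (ImZ a) g u) / 2"


section \<open>Smooth manifolds\<close>

text \<open>A chart is given by its parametrization: an open subset of the model space together with
  a homeomorphism from it onto an open subset of the manifold. The model C^m x R^n is R^(2m+n).\<close>

type_synonym 'a chart = "point set \<times> (point \<Rightarrow> 'a)"

abbreviation chart_dom :: "'a chart \<Rightarrow> point set" where "chart_dom \<equiv> fst"
abbreviation chart_par :: "'a chart \<Rightarrow> point \<Rightarrow> 'a" where "chart_par \<equiv> snd"

definition chart_ran :: "'a chart \<Rightarrow> 'a set" where
  "chart_ran c = chart_par c ` chart_dom c"

definition chart_coords :: "'a chart \<Rightarrow> 'a \<Rightarrow> point" where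
  "chart_coords c = the_inv_into (chart_dom c) (chart_par c)"

definition is_chart :: "'a topology \<Rightarrow> nat \<Rightarrow> nat \<Rightarrow> 'a chart \<Rightarrow> bool" where
  "is_chart X m n c \<longleftrightarrow>
     openin (top_of_set (model_space m n)) (chart_dom c) \<and>
     openin X (chart_ran c) \<and>
     homeomorphic_map (top_of_set (chart_dom c)) (subtopology X (chart_ran c)) (chart_par c)"

definition overlap :: "'a chart \<Rightarrow> 'a chart \<Rightarrow> point set" where
  "overlap c c' = {u \<in> chart_dom c. chart_par c u \<in> chart_ran c'}"

definition transition :: "'a chart \<Rightarrow> 'a chart \<Rightarrow> point \<Rightarrow> point" where
  "transition c c' u = chart_coords c' (chart_par c u)"

definition compatible :: "nat \<Rightarrow> nat \<Rightarrow> 'a chart \<Rightarrow> 'a chart \<Rightarrow> bool" where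
  "compatible m n c c' \<longleftrightarrow>
     smooth_map_on m n (overlap c c') (transition c c') \<and>
     smooth_map_on m n (overlap c' c) (transition c' c)"

locale smooth_manifold =
  fixes X :: "'a topology" and m n :: nat and Atl :: "'a chart set"
  assumes hausdorff: "Hausdorff_space X"
    and second_countable: "second_countable X"
    and charts: "\<And>c. c \<in> Atl \<Longrightarrow> is_chart X m n c"
    and atlas_covers: "topspace X = (\<Union>c\<in>Atl. chart_ran c)"
    and atlas_compatible: "\<And>c c'. c \<in> Atl \<Longrightarrow> c' \<in> Atl \<Longrightarrow> compatible m n c c'"
    and atlas_maximal:
      "\<And>c. is_chart X m n c \<Longrightarrow> (\<And>c'. c' \<in> Atl \<Longrightarrow> compatible m n c c') \<Longrightarrow> c \<in> Atl"

definition smooth_function :: "nat \<Rightarrow> nat \<Rightarrow> 'a chart set \<Rightarrow> ('a \<Rightarrow> complex) \<Rightarrow> bool" where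
  "smooth_function m n Atl f \<longleftrightarrow>
     (\<forall>c\<in>Atl. smooth_on m n (chart_dom c) (\<lambda>u. f (chart_par c u)))"


section \<open>Complex foliations\<close>

text \<open>
  F i is the pair of Omega_i x O_i and phi_i. Membership of F i in the maximal atlas says that
  phi_i is a diffeomorphism onto the open set U_i = chart_ran (F i). A map between open subsets
  of C^m is holomorphic if it is continuous (here: smooth) and each component is complex
  differentiable in each variable separately.
\<close>

locale complex_foliation = smooth_manifold X m n Atl
  for X :: "'a topology" and m n :: nat and Atl :: "'a chart set" +
  fixes I :: "'i set" and F :: "'i \<Rightarrow> 'a chart"
  assumes adapted_domain: "\<And>i. i \<in> I \<Longrightarrow>
      \<exists>c r d s. (\<forall>k<m. 0 < r k) \<and> 0 < s \<and> chart_dom (F i) = polydisc m c r \<times> open_ball n d s"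
    and adapted_diffeo: "\<And>i. i \<in> I \<Longrightarrow> F i \<in> Atl"
    and adapted_covers: "topspace X = (\<Union>i\<in>I. chart_ran (F i))"
    and transverse: "\<And>i j. i \<in> I \<Longrightarrow> j \<in> I \<Longrightarrow>
      \<exists>\<phi>2. \<forall>(z, x) \<in> overlap (F i) (F j). snd (transition (F i) (F j) (z, x)) = \<phi>2 x"
    and leafwise_holomorphic: "\<And>i j z x a b. i \<in> I \<Longrightarrow> j \<in> I \<Longrightarrow>
      (z, x) \<in> overlap (F i) (F j) \<Longrightarrow> a < m \<Longrightarrow> b < m \<Longrightarrow>
      (\<lambda>w. fst (transition (F i) (F j) (z(b := w), x)) a) field_differentiable (at (z b))"


section \<open>The exterior algebra on dz^a and their conjugates\<close>

text \<open>
  Generators are numbered by naturals: a < m stands for dz^a and m + a for its conjugate.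
  An element is its family of coefficients, the coefficient at a finite set S belonging to the
  wedge product of the generators in S in increasing order; thus A \<union> (+) m ` B is the
  index of dz^A \<and> dzbar^B.
\<close>

type_synonym ext = "nat set \<Rightarrow> complex"

definition shuffle_sign :: "nat set \<Rightarrow> nat set \<Rightarrow> complex" where
  "shuffle_sign S T = (- 1) ^ card {(s, t). s \<in> S \<and> t \<in> T \<and> t < s}"

definition wedge :: "ext \<Rightarrow> ext \<Rightarrow> ext" where
  "wedge \<alpha> \<beta> = (\<lambda>R. \<Sum>S\<in>Pow R. shuffle_sign S (R - S) * \<alpha> S * \<beta> (R - S))"

definition ext_one :: ext where
  "ext_one = (\<lambda>S. if S = {} then 1 else 0)"

definition covec :: "nat \<Rightarrow> ext" where
  "covec k = (\<lambda>S. if S = {k} then 1 else 0)"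

definition of_type :: "nat \<Rightarrow> nat \<Rightarrow> nat \<Rightarrow> nat set \<Rightarrow> bool" where
  "of_type m p q S \<longleftrightarrow> S \<subseteq> {..<2 * m} \<and> card (S \<inter> {..<m}) = p \<and> card (S - {..<m}) = q"

text \<open>The algebra homomorphism with dz'^a mapped to the sum of the J a b dz^b, and dzbar'^a to
  the sum of the cnj (J a b) dzbar^b.\<close>

definition pullback_covec :: "nat \<Rightarrow> (nat \<Rightarrow> nat \<Rightarrow> complex) \<Rightarrow> nat \<Rightarrow> ext" where
  "pullback_covec m J k =
     (if k < m then (\<lambda>S. \<Sum>b<m. J k b * covec b S)
      else (\<lambda>S. \<Sum>b<m. cnj (J (k - m) b) * covec (m + b) S))"

definition pullback :: "nat \<Rightarrow> (nat \<Rightarrow> nat \<Rightarrow> complex) \<Rightarrow> ext \<Rightarrow> ext" where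
  "pullback m J \<alpha> = (\<lambda>R. \<Sum>S\<in>Pow {..<2 * m}.
     \<alpha> S * foldr wedge (map (pullback_covec m J) (sorted_list_of_set S)) ext_one R)"

definition leaf_jacobian :: "'a chart \<Rightarrow> 'a chart \<Rightarrow> point \<Rightarrow> nat \<Rightarrow> nat \<Rightarrow> complex" where
  "leaf_jacobian c c' u a b =
     deriv (\<lambda>w. fst (transition c c' ((fst u)(b := w), snd u)) a) (fst u b)"


section \<open>Foliated forms and the leafwise Dolbeault operators\<close>

text \<open>
  A section of the exterior algebra bundle of the complexified leafwise cotangent bundle is its
  family of local expressions: \<omega> i x is the value at x written in the coframe of the chart
  F i, and expressions on overlaps are related by the leafwise change of coordinates. Values that
  carry no information are required to be 0, so that equal forms are equal as functions.
\<close>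

type_synonym ('i, 'a) form = "'i \<Rightarrow> 'a \<Rightarrow> ext"

definition foliated_forms ::
  "nat \<Rightarrow> nat \<Rightarrow> 'i set \<Rightarrow> ('i \<Rightarrow> 'a chart) \<Rightarrow> nat \<Rightarrow> nat \<Rightarrow> ('i, 'a) form set" where
  "foliated_forms m n I F p q = {\<omega>.
     (\<forall>i x S. \<not> (i \<in> I \<and> x \<in> chart_ran (F i) \<and> of_type m p q S) \<longrightarrow> \<omega> i x S = 0) \<and>
     (\<forall>i\<in>I. \<forall>S. smooth_on m n (chart_dom (F i)) (\<lambda>u. \<omega> i (chart_par (F i) u) S)) \<and>
     (\<forall>i\<in>I. \<forall>j\<in>I. \<forall>x\<in>chart_ran (F i) \<inter> chart_ran (F j).
        \<omega> i x = pullback m (leaf_jacobian (F i) (F j) (chart_coords (F i) x)) (\<omega> j x))}"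

definition function_form :: "'i set \<Rightarrow> ('i \<Rightarrow> 'a chart) \<Rightarrow> ('a \<Rightarrow> complex) \<Rightarrow> ('i, 'a) form" where
  "function_form I F f =
     (\<lambda>i x S. if i \<in> I \<and> x \<in> chart_ran (F i) then f x * ext_one S else 0)"

definition dbar :: "nat \<Rightarrow> 'i set \<Rightarrow> ('i \<Rightarrow> 'a chart) \<Rightarrow> ('i, 'a) form \<Rightarrow> ('i, 'a) form" where
  "dbar m I F \<omega> = (\<lambda>i x R. if i \<in> I \<and> x \<in> chart_ran (F i) then
     (\<Sum>a<m. wedge (covec (m + a))
        (\<lambda>S. wirtinger_bar a (\<lambda>u. \<omega> i (chart_par (F i) u) S) (chart_coords (F i) x)) R)
     else 0)"

definition dbar_twisted ::
  "nat \<Rightarrow> 'i set \<Rightarrow> ('i \<Rightarrow> 'a chart) \<Rightarrow> ('a \<Rightarrow> complex) \<Rightarrow> nat \<Rightarrow> nat \<Rightarrow>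
    ('i, 'a) form \<Rightarrow> ('i, 'a) form" where
  "dbar_twisted m I F f p q \<omega> = (\<lambda>i x S. f x * dbar m I F \<omega> i x S
     - of_nat (p + q) * wedge (dbar m I F (function_form I F f) i x) (\<omega> i x) S)"


section \<open>Cohomology\<close>

text \<open>
  Complex vector spaces are module records with scalars of type complex; the ring
  multiplication of these records is junk.
\<close>

definition quotient_module :: "('c, 'v) module \<Rightarrow> 'v set \<Rightarrow> ('c, 'v set) module" where
  "quotient_module M N =
     \<lparr>carrier = a_rcosets\<^bsub>M\<^esub> N, mult = undefined, one = undefined,
      zero = N, add = set_add M,
      smult = (\<lambda>c C. \<Union>v\<in>C. N +>\<^bsub>M\<^esub> (c \<odot>\<^bsub>M\<^esub> v))\<rparr>"

definition isomorphic_complex_spaces ::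
  "(complex, 'v) module \<Rightarrow> (complex, 'w) module \<Rightarrow> bool" where
  "isomorphic_complex_spaces V W \<longleftrightarrow> (\<exists>\<Phi>. bij_betw \<Phi> (carrier V) (carrier W) \<and>
     (\<forall>u\<in>carrier V. \<forall>v\<in>carrier V. \<Phi> (u \<oplus>\<^bsub>V\<^esub> v) = \<Phi> u \<oplus>\<^bsub>W\<^esub> \<Phi> v) \<and>
     (\<forall>c. \<forall>v\<in>carrier V. \<Phi> (c \<odot>\<^bsub>V\<^esub> v) = c \<odot>\<^bsub>W\<^esub> \<Phi> v))"

definition cocycles ::
  "nat \<Rightarrow> nat \<Rightarrow> 'i set \<Rightarrow> ('i \<Rightarrow> 'a chart) \<Rightarrow> ('a \<Rightarrow> complex) \<Rightarrow> nat \<Rightarrow> nat \<Rightarrow>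
    ('i, 'a) form set" where
  "cocycles m n I F f p q =
     {\<omega> \<in> foliated_forms m n I F p q. dbar_twisted m I F f p q \<omega> = (\<lambda>i x S. 0)}"

definition coboundaries ::
  "nat \<Rightarrow> nat \<Rightarrow> 'i set \<Rightarrow> ('i \<Rightarrow> 'a chart) \<Rightarrow> ('a \<Rightarrow> complex) \<Rightarrow> nat \<Rightarrow> nat \<Rightarrow>
    ('i, 'a) form set" where
  "coboundaries m n I F f p q =
     (case q of 0 \<Rightarrow> {\<lambda>i x S. 0}
      | Suc q' \<Rightarrow> dbar_twisted m I F f p q' ` foliated_forms m n I F p q')"

definition cocycle_module ::
  "nat \<Rightarrow> nat \<Rightarrow> 'i set \<Rightarrow> ('i \<Rightarrow> 'a chart) \<Rightarrow> ('a \<Rightarrow> complex) \<Rightarrow> nat \<Rightarrow> nat \<Rightarrow>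
    (complex, ('i, 'a) form) module" where
  "cocycle_module m n I F f p q =
     \<lparr>carrier = cocycles m n I F f p q, mult = undefined, one = undefined,
      zero = (\<lambda>i x S. 0), add = (\<lambda>\<omega> \<eta> i x S. \<omega> i x S + \<eta> i x S),
      smult = (\<lambda>c \<omega> i x S. c * \<omega> i x S)\<rparr>"

definition foliated_cohomology ::
  "nat \<Rightarrow> nat \<Rightarrow> 'i set \<Rightarrow> ('i \<Rightarrow> 'a chart) \<Rightarrow> ('a \<Rightarrow> complex) \<Rightarrow> nat \<Rightarrow> nat \<Rightarrow>
    (complex, ('i, 'a) form set) module" where
  "foliated_cohomology m n I F f p q =
     quotient_module (cocycle_module m n I F f p q) (coboundaries m n I F f p q)"

end

theory Submission
  imports Defs
begin

text \<open>
  Multiplying a form of type (p, q) by the (p + q)-th power of h turns the operator twisted by f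
  into the operator twisted by f h. For k = p + q the Leibniz rule gives
    fh dbar(h^k \<omega>) - k dbar(fh) \<and> h^k \<omega> =
      fh (h^k dbar \<omega> + k h^(k-1) dbar h \<and> \<omega>) - k (f dbar h + h dbar f) \<and> h^k \<omega>,
  in which the two terms with dbar h cancel, leaving h^(k+1) (f dbar \<omega> - k dbar f \<and> \<omega>).
  The exponent k + 1 is the one that belongs to the target type (p, q + 1), so multiplication by
  h^(p+q) is a morphism between the two complexes (dbar_twisted_intertwines). As h has no zeros, the
  powers of 1/h are smooth as well and provide the inverse morphism. Hence multiplication by
  h^(p+q) maps cocycles onto cocycles and coboundaries onto coboundaries, and so induces an
  isomorphism of the quotients (isomorphic_quotient_modules).

  The Leibniz rule can be applied chart by chart, to coefficients. Forms remain forms after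
  multiplication by a function because the change of coordinates is linear over functions.
  The induced map on cosets is injective because all families of local expressions in sight
  vanish off their charts, and hence wherever h might vanish.
\<close>

section \<open>Calculus in the model space\<close>

lemma shift_0 [simp]: "shift c 0 u = u"
  by (cases u; cases c) auto

lemma has_partial_iff:
  "has_partial c g u \<longleftrightarrow> ((\<lambda>t. g (shift c t u)) has_vector_derivative partial c g u) (at 0)"
  by (simp add: has_partial_def partial_def vector_derivative_works)

lemma has_partialI:
  assumes "((\<lambda>t. g (shift c t u)) has_vector_derivative d) (at 0)"
  shows "has_partial c g u" "partial c g u = d"
  using assms by (auto simp: has_partial_def partial_def vector_derivative_at
      intro: differentiableI_vector)

lemma partial_const: "has_partial c (\<lambda>u. b) u" "partial c (\<lambda>u. b) u = 0"
  using has_partialI[of "\<lambda>u. b" c u 0] by simp_all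

lemma partial_add:
  assumes "has_partial c g u" "has_partial c g' u"
  shows "has_partial c (\<lambda>u. g u + g' u) u"
    and "partial c (\<lambda>u. g u + g' u) u = partial c g u + partial c g' u"
  using has_vector_derivative_add[OF assms[unfolded has_partial_iff]]
  by (rule has_partialI)+

lemma partial_mult:
  assumes "has_partial c g u" "has_partial c g' u"
  shows "has_partial c (\<lambda>u. g u * g' u) u"
    and "partial c (\<lambda>u. g u * g' u) u = g u * partial c g' u + partial c g u * g' u"
  using has_vector_derivative_mult[OF assms[unfolded has_partial_iff]]
  by (auto dest: has_partialI)

lemma partial_inverse:
  assumes "has_partial c g u" "g u \<noteq> 0"
  shows "has_partial c (\<lambda>u. inverse (g u)) u"
    and "partial c (\<lambda>u. inverse (g u)) u = (- 1) * partial c g u * (inverse (g u) * inverse (g u))"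
proof -
  have "(inverse has_field_derivative - (inverse (g u) ^ 2)) (at (g (shift c 0 u)))"
    using DERIV_inverse[OF assms(2), of UNIV] by (simp add: numeral_2_eq_2)
  from field_vector_diff_chain_at[OF assms(1)[unfolded has_partial_iff] this]
  have "((\<lambda>t. inverse (g (shift c t u))) has_vector_derivative
      (- 1) * partial c g u * (inverse (g u) * inverse (g u))) (at 0)"
    by (simp add: o_def power2_eq_square)
  then show "has_partial c (\<lambda>u. inverse (g u)) u"
    and "partial c (\<lambda>u. inverse (g u)) u = (- 1) * partial c g u * (inverse (g u) * inverse (g u))"
    by (rule has_partialI)+
qed

lemma shift_in_model_space:
  "c \<in> real_coords m n \<Longrightarrow> u \<in> model_space m n \<Longrightarrow> shift c t u \<in> model_space m n"
  by (cases u) (auto simp: real_coords_def model_space_def)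

lemma continuous_on_shift: "continuous_on UNIV (\<lambda>t. shift c t u)"
proof -
  obtain z x where u: "u = (z, x)" by (cases u)
  have upd: "continuous_on UNIV (\<lambda>t. w(k := e t))"
    if "continuous_on UNIV e" for w :: "nat \<Rightarrow> 'b::topological_space" and k and e :: "real \<Rightarrow> 'b"
  proof (rule continuous_on_coordinatewise_then_product)
    show "continuous_on UNIV (\<lambda>t. (w(k := e t)) i)" for i
      using that by (cases "i = k") auto
  qed
  show ?thesis
    by (cases c) (simp_all only: u shift.simps, (intro continuous_on_Pair upd continuous_intros)+)
qed

text \<open>Partial derivatives on a relatively open set are local: a short segment in any of the
  coordinate directions of the model space stays inside the set.\<close>

lemma eventually_shift_in:
  assumes W: "openin (top_of_set (model_space m n)) W" and c: "c \<in> real_coords m n" and u: "u \<in> W"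
  shows "eventually (\<lambda>t. shift c t u \<in> W) (nhds 0)"
proof -
  obtain V where V: "open V" "W = model_space m n \<inter> V"
    using W by (auto simp: openin_open)
  have "open ((\<lambda>t. shift c t u) -` V)"
    using V(1) continuous_on_shift by (rule open_vimage)
  moreover have "0 \<in> (\<lambda>t. shift c t u) -` V"
    using u V(2) by simp
  ultimately have "eventually (\<lambda>t. t \<in> (\<lambda>t. shift c t u) -` V) (nhds 0)"
    by (rule eventually_nhds_in_open)
  then show ?thesis
    by eventually_elim (use u V(2) shift_in_model_space[OF c] in auto)
qed

lemma partial_cong:
  assumes W: "openin (top_of_set (model_space m n)) W" and c: "c \<in> real_coords m n" and u: "u \<in> W"
    and eq: "\<And>v. v \<in> W \<Longrightarrow> g v = g' v"
  shows "has_partial c g u \<longleftrightarrow> has_partial c g' u" "partial c g u = partial c g' u"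
proof -
  have "eventually (\<lambda>t. g (shift c t u) = g' (shift c t u)) (nhds 0)"
    using eventually_shift_in[OF W c u] by eventually_elim (rule eq)
  then have *: "((\<lambda>t. g (shift c t u)) has_vector_derivative d) (at 0) \<longleftrightarrow>
      ((\<lambda>t. g' (shift c t u)) has_vector_derivative d) (at 0)" for d
    by (intro has_vector_derivative_cong_ev) (use eq[OF u] in \<open>auto elim: eventually_mono\<close>)
  show p: "partial c g u = partial c g' u"
    unfolding partial_def vector_derivative_def * ..
  show "has_partial c g u \<longleftrightarrow> has_partial c g' u"
    unfolding has_partial_iff * p ..
qed

text \<open>Because partial derivatives are local, a derivative of a product or of a reciprocal can be
  replaced by its formula, which is valid on W only.\<close>

lemma C_times_cong:
  assumes "openin (top_of_set (model_space m n)) W" "\<And>v. v \<in> W \<Longrightarrow> g v = g' v"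
  shows "C_times k m n W g \<longleftrightarrow> C_times k m n W g'"
  using assms(2)
proof (induction k arbitrary: g g')
  case 0
  then show ?case by (auto cong: continuous_on_cong)
next
  case (Suc k)
  have "C_times k m n W (partial c g) \<longleftrightarrow> C_times k m n W (partial c g')" if "c \<in> real_coords m n" for c
    by (intro Suc.IH partial_cong(2)[OF assms(1) that]) (auto simp: Suc.prems)
  moreover have "has_partial c g u \<longleftrightarrow> has_partial c g' u" if "c \<in> real_coords m n" "u \<in> W" for c u
    by (intro partial_cong(1)[OF assms(1) that]) (auto simp: Suc.prems)
  moreover have "continuous_on W g \<longleftrightarrow> continuous_on W g'"
    by (intro continuous_on_cong) (auto simp: Suc.prems)
  ultimately show ?case by auto
qed

lemma C_times_lower: "C_times (Suc k) m n W g \<Longrightarrow> C_times k m n W g"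
  by (induction k arbitrary: g) auto

lemma C_times_const: "C_times k m n W (\<lambda>u. b)"
proof (induction k arbitrary: b)
  case (Suc k)
  have "partial c (\<lambda>u. b) = (\<lambda>u. 0)" for c
    by (rule ext) (rule partial_const)
  then show ?case using Suc by (auto simp: partial_const)
qed auto

lemma C_times_add:
  assumes W: "openin (top_of_set (model_space m n)) W"
  shows "C_times k m n W g \<Longrightarrow> C_times k m n W g' \<Longrightarrow> C_times k m n W (\<lambda>u. g u + g' u)"
proof (induction k arbitrary: g g')
  case (Suc k)
  have "C_times k m n W (partial c (\<lambda>u. g u + g' u))" if c: "c \<in> real_coords m n" for c
  proof -
    have "C_times k m n W (\<lambda>u. partial c g u + partial c g' u)"
      using Suc c by auto
    then show ?thesis
      by (subst C_times_cong[OF W, of _ "\<lambda>u. partial c g u + partial c g' u"])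
        (use Suc.prems c in \<open>auto simp: partial_add\<close>)
  qed
  then show ?case using Suc.prems by (auto intro!: continuous_intros partial_add)
qed (auto intro: continuous_intros)

lemma C_times_mult:
  assumes W: "openin (top_of_set (model_space m n)) W"
  shows "C_times k m n W g \<Longrightarrow> C_times k m n W g' \<Longrightarrow> C_times k m n W (\<lambda>u. g u * g' u)"
proof (induction k arbitrary: g g')
  case (Suc k)
  have "C_times k m n W (partial c (\<lambda>u. g u * g' u))" if c: "c \<in> real_coords m n" for c
  proof -
    have "C_times k m n W (\<lambda>u. g u * partial c g' u + partial c g u * g' u)"
      by (intro C_times_add[OF W] Suc.IH Suc.prems[THEN C_times_lower]) (use Suc.prems c in auto)
    then show ?thesis
      by (subst C_times_cong[OF W, of _ "\<lambda>u. g u * partial c g' u + partial c g u * g' u"])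
        (use Suc.prems c in \<open>auto simp: partial_mult\<close>)
  qed
  then show ?case using Suc.prems by (auto intro!: continuous_intros partial_mult)
qed (auto intro: continuous_intros)

lemma C_times_inverse:
  assumes W: "openin (top_of_set (model_space m n)) W" and nz: "\<And>u. u \<in> W \<Longrightarrow> g u \<noteq> 0"
  shows "C_times k m n W g \<Longrightarrow> C_times k m n W (\<lambda>u. inverse (g u))"
proof (induction k)
  case (Suc k)
  have inv: "C_times k m n W (\<lambda>u. inverse (g u))"
    using Suc.IH Suc.prems C_times_lower by blast
  have "C_times k m n W (partial c (\<lambda>u. inverse (g u)))" if c: "c \<in> real_coords m n" for c
  proof -
    have "C_times k m n W (\<lambda>u. (- 1) * partial c g u * (inverse (g u) * inverse (g u)))"
      by (intro C_times_mult[OF W] C_times_const inv) (use Suc.prems c in auto)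
    then show ?thesis
      by (subst C_times_cong[OF W, of _ "\<lambda>u. (- 1) * partial c g u * (inverse (g u) * inverse (g u))"])
        (use Suc.prems c nz in \<open>auto simp: partial_inverse\<close>)
  qed
  then show ?case
    using Suc.prems nz by (auto intro!: continuous_on_inverse partial_inverse)
qed (auto intro!: continuous_on_inverse nz)

lemma smooth_on_mult:
  assumes "openin (top_of_set (model_space m n)) W" "smooth_on m n W g" "smooth_on m n W g'"
  shows "smooth_on m n W (\<lambda>u. g u * g' u)"
  using assms by (auto simp: smooth_on_def intro: C_times_mult)

lemma smooth_on_power:
  assumes "openin (top_of_set (model_space m n)) W" "smooth_on m n W g"
  shows "smooth_on m n W (\<lambda>u. g u ^ k)"
proof (induction k)
  case 0
  show ?case by (simp add: smooth_on_def C_times_const)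
next
  case (Suc k)
  then show ?case using smooth_on_mult[OF assms] by simp
qed

lemma smooth_on_inverse:
  assumes "openin (top_of_set (model_space m n)) W" "smooth_on m n W g" "\<And>u. u \<in> W \<Longrightarrow> g u \<noteq> 0"
  shows "smooth_on m n W (\<lambda>u. inverse (g u))"
  using assms by (auto simp: smooth_on_def intro: C_times_inverse)

lemma smooth_on_has_partial:
  assumes "smooth_on m n W g" "u \<in> W" "c \<in> real_coords m n"
  shows "has_partial c g u"
  using assms(1)[unfolded smooth_on_def, rule_format, of "Suc 0"] assms(2,3) by simp

lemma ReZ_ImZ_in_real_coords: "a < m \<Longrightarrow> ReZ a \<in> real_coords m n" "a < m \<Longrightarrow> ImZ a \<in> real_coords m n"
  by (auto simp: real_coords_def)

lemma wirtinger_bar_cong: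
  assumes "openin (top_of_set (model_space m n)) W" "u \<in> W" "a < m" "\<And>v. v \<in> W \<Longrightarrow> g v = g' v"
  shows "wirtinger_bar a g u = wirtinger_bar a g' u"
proof -
  have "partial c g u = partial c g' u" if "c \<in> real_coords m n" for c
    using assms(1) that assms(2,4) by (rule partial_cong(2))
  then show ?thesis
    by (simp only: wirtinger_bar_def ReZ_ImZ_in_real_coords[OF assms(3)])
qed

lemma wirtinger_bar_const: "wirtinger_bar a (\<lambda>u. b) u = 0"
  by (simp add: wirtinger_bar_def partial_const)

lemma wirtinger_bar_mult:
  assumes "smooth_on m n W g" "smooth_on m n W g'" "u \<in> W" "a < m"
  shows "wirtinger_bar a (\<lambda>u. g u * g' u) u = g u * wirtinger_bar a g' u + wirtinger_bar a g u * g' u"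
proof -
  have "has_partial c g u" "has_partial c g' u" if "c \<in> real_coords m n" for c
    using smooth_on_has_partial assms that by blast+
  note this[OF ReZ_ImZ_in_real_coords(1)[OF assms(4)]] this[OF ReZ_ImZ_in_real_coords(2)[OF assms(4)]]
  then show ?thesis
    by (simp add: wirtinger_bar_def partial_mult field_simps)
qed

text \<open>The power rule is multiplied by g to avoid the exponent k - 1, and with it a separate
  treatment of k = 0.\<close>

lemma wirtinger_bar_power:
  assumes "openin (top_of_set (model_space m n)) W" "smooth_on m n W g" "u \<in> W" "a < m"
  shows "g u * wirtinger_bar a (\<lambda>u. g u ^ k) u = of_nat k * g u ^ k * wirtinger_bar a g u"
proof (induction k)
  case 0
  show ?case by (simp add: wirtinger_bar_const)
next
  case (Suc k)
  show ?case
    using wirtinger_bar_mult[OF assms(2) smooth_on_power[OF assms(1,2), of k] assms(3,4)] Suc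
    by (simp add: algebra_simps)
qed


section \<open>Exterior algebra\<close>

lemma wedge_scale_right: "wedge \<alpha> (\<lambda>S. c * \<beta> S) R = c * wedge \<alpha> \<beta> R"
  by (simp add: wedge_def sum_distrib_left mult_ac)

lemma wedge_scale_left: "wedge (\<lambda>S. c * \<alpha> S) \<beta> R = c * wedge \<alpha> \<beta> R"
  by (simp add: wedge_def sum_distrib_left mult_ac)

lemma wedge_add_right: "wedge \<alpha> (\<lambda>S. \<beta> S + \<gamma> S) R = wedge \<alpha> \<beta> R + wedge \<alpha> \<gamma> R"
  by (simp add: wedge_def sum.distrib distrib_left)

lemma wedge_sum_left: "wedge (\<lambda>S. \<Sum>a\<in>A. \<alpha> a S) \<beta> R = (\<Sum>a\<in>A. wedge (\<alpha> a) \<beta> R)"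
  unfolding wedge_def by (subst sum.swap) (simp add: sum_distrib_left sum_distrib_right)

lemma wedge_zero_left: "wedge (\<lambda>S. 0) \<beta> R = 0"
  by (simp add: wedge_def)

text \<open>For infinite R the sum in the wedge product is 0 by convention, which is the right value, as
  generators have no coefficient there.\<close>

lemma wedge_covec_one: "wedge (covec k) ext_one = covec k"
proof
  fix R
  show "wedge (covec k) ext_one R = covec k R"
  proof (cases "finite R")
    case True
    have "wedge (covec k) ext_one R
        = (\<Sum>S\<in>Pow R. if S = R then shuffle_sign R {} * covec k R else 0)"
      unfolding wedge_def by (rule sum.cong) (auto simp: ext_one_def)
    then show ?thesis using True by (simp add: shuffle_sign_def)
  next
    case False
    then show ?thesis by (auto simp: wedge_def covec_def)
  qed
qed

lemma pullback_scale: "pullback m J (\<lambda>S. c * \<alpha> S) = (\<lambda>R. c * pullback m J \<alpha> R)"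
  by (simp add: pullback_def sum_distrib_left mult_ac)


section \<open>Rescaling the complex\<close>

definition scale_form :: "('a \<Rightarrow> complex) \<Rightarrow> ('i, 'a) form \<Rightarrow> ('i, 'a) form" where
  "scale_form g \<omega> = (\<lambda>i x S. g x * \<omega> i x S)"

context complex_foliation
begin

abbreviation smooth_adapted :: "('a \<Rightarrow> complex) \<Rightarrow> bool" where
  "smooth_adapted g \<equiv> \<forall>i\<in>I. smooth_on m n (chart_dom (F i)) (\<lambda>u. g (chart_par (F i) u))"

lemma adapted_open: "i \<in> I \<Longrightarrow> openin (top_of_set (model_space m n)) (chart_dom (F i))"
  using charts[OF adapted_diffeo] by (simp add: is_chart_def)

lemma adapted_coords:
  assumes "i \<in> I" "x \<in> chart_ran (F i)"
  shows "chart_coords (F i) x \<in> chart_dom (F i)" "chart_par (F i) (chart_coords (F i) x) = x"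
proof -
  have "homeomorphic_map (top_of_set (chart_dom (F i))) (subtopology X (chart_ran (F i)))
      (chart_par (F i))"
    using charts[OF adapted_diffeo[OF assms(1)]] by (simp add: is_chart_def)
  then have "inj_on (chart_par (F i)) (chart_dom (F i))"
    by (auto dest: homeomorphic_imp_injective_map)
  then show "chart_coords (F i) x \<in> chart_dom (F i)" "chart_par (F i) (chart_coords (F i) x) = x"
    using assms(2) by (auto simp: chart_coords_def chart_ran_def the_inv_into_into f_the_inv_into_f)
qed

lemma chart_ran_subset: "i \<in> I \<Longrightarrow> chart_ran (F i) \<subseteq> topspace X"
  using adapted_covers by auto

lemma smooth_adapted_of_smooth_function: "smooth_function m n Atl g \<Longrightarrow> smooth_adapted g"
  using adapted_diffeo by (auto simp: smooth_function_def)

lemma smooth_adapted_power: "smooth_adapted g \<Longrightarrow> smooth_adapted (\<lambda>x. g x ^ k)"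
  using adapted_open by (auto intro: smooth_on_power)

lemma smooth_adapted_inverse:
  assumes "smooth_adapted g" "\<And>x. x \<in> topspace X \<Longrightarrow> g x \<noteq> 0"
  shows "smooth_adapted (\<lambda>x. inverse (g x))"
proof
  fix i assume i: "i \<in> I"
  show "smooth_on m n (chart_dom (F i)) (\<lambda>u. inverse (g (chart_par (F i) u)))"
    by (rule smooth_on_inverse[OF adapted_open[OF i]])
      (use assms i chart_ran_subset[OF i] in \<open>auto simp: chart_ran_def\<close>)
qed

lemma forms_vanish_off_charts:
  "\<omega> \<in> foliated_forms m n I F p q \<Longrightarrow> \<not> (i \<in> I \<and> x \<in> chart_ran (F i)) \<Longrightarrow> \<omega> i x S = 0"
  unfolding foliated_forms_def by blast

lemma forms_smooth:
  "\<omega> \<in> foliated_forms m n I F p q \<Longrightarrow> i \<in> I \<Longrightarrow>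
    smooth_on m n (chart_dom (F i)) (\<lambda>u. \<omega> i (chart_par (F i) u) S)"
  unfolding foliated_forms_def by blast

lemma scale_form_in_forms:
  assumes "smooth_adapted g" "\<omega> \<in> foliated_forms m n I F p q"
  shows "scale_form g \<omega> \<in> foliated_forms m n I F p q"
proof -
  have "smooth_on m n (chart_dom (F i)) (\<lambda>u. scale_form g \<omega> i (chart_par (F i) u) S)" if "i \<in> I" for i S
    unfolding scale_form_def
    by (rule smooth_on_mult[OF adapted_open[OF that]]) (use assms that in \<open>auto dest: forms_smooth\<close>)
  moreover have "scale_form g \<omega> i x = pullback m (leaf_jacobian (F i) (F j) (chart_coords (F i) x))
      (scale_form g \<omega> j x)" if "i \<in> I" "j \<in> I" "x \<in> chart_ran (F i) \<inter> chart_ran (F j)" for i j x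
  proof -
    have "\<omega> i x = pullback m (leaf_jacobian (F i) (F j) (chart_coords (F i) x)) (\<omega> j x)"
      using assms(2) that unfolding foliated_forms_def by blast
    then show ?thesis by (simp add: scale_form_def pullback_scale)
  qed
  moreover have "scale_form g \<omega> i x S = 0" if "\<not> (i \<in> I \<and> x \<in> chart_ran (F i) \<and> of_type m p q S)"
    for i x S
  proof -
    have "\<omega> i x S = 0" using assms(2) that unfolding foliated_forms_def by blast
    then show ?thesis by (simp add: scale_form_def)
  qed
  ultimately show ?thesis
    unfolding foliated_forms_def by blast
qed

lemma scale_form_inverse:
  assumes "\<And>x. x \<in> topspace X \<Longrightarrow> g x \<noteq> 0"
    and "\<And>i x S. \<not> (i \<in> I \<and> x \<in> chart_ran (F i)) \<Longrightarrow> \<omega> i x S = 0"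
  shows "scale_form g (scale_form (\<lambda>x. inverse (g x)) \<omega>) = \<omega>"
    and "scale_form (\<lambda>x. inverse (g x)) (scale_form g \<omega>) = \<omega>"
proof -
  have "g x * (inverse (g x) * \<omega> i x S) = \<omega> i x S" "inverse (g x) * (g x * \<omega> i x S) = \<omega> i x S" for i x S
    using assms(1)[of x] assms(2)[of i x S] chart_ran_subset[of i] by fastforce+
  then show "scale_form g (scale_form (\<lambda>x. inverse (g x)) \<omega>) = \<omega>"
    and "scale_form (\<lambda>x. inverse (g x)) (scale_form g \<omega>) = \<omega>"
    unfolding scale_form_def by blast+
qed

text \<open>Together with the same property of forms, this puts all cosets of coboundaries into a space of
  families on which multiplication by a power of h is injective.\<close>

lemma dbar_twisted_vanishes_off_charts:
  assumes "\<not> (i \<in> I \<and> x \<in> chart_ran (F i))"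
  shows "dbar_twisted m I F f p q \<omega> i x S = 0"
proof -
  have "dbar m I F \<eta> i x = (\<lambda>S. 0)" for \<eta>
    using assms unfolding dbar_def by auto
  then show ?thesis by (simp add: dbar_twisted_def wedge_zero_left)
qed

lemma scale_form_image:
  assumes "smooth_adapted g" "\<And>x. x \<in> topspace X \<Longrightarrow> g x \<noteq> 0"
  shows "scale_form g ` foliated_forms m n I F p q = foliated_forms m n I F p q"
proof
  show "scale_form g ` foliated_forms m n I F p q \<subseteq> foliated_forms m n I F p q"
    using scale_form_in_forms[OF assms(1)] by auto
  show "foliated_forms m n I F p q \<subseteq> scale_form g ` foliated_forms m n I F p q"
  proof
    fix \<omega> assume \<omega>: "\<omega> \<in> foliated_forms m n I F p q"
    have "scale_form (\<lambda>x. inverse (g x)) \<omega> \<in> foliated_forms m n I F p q"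
      by (rule scale_form_in_forms[OF smooth_adapted_inverse[OF assms] \<omega>])
    moreover have "\<omega> = scale_form g (scale_form (\<lambda>x. inverse (g x)) \<omega>)"
      by (rule scale_form_inverse(1)[symmetric]) (use assms(2) forms_vanish_off_charts[OF \<omega>] in auto)
    ultimately show "\<omega> \<in> scale_form g ` foliated_forms m n I F p q" by blast
  qed
qed

lemma dbar_function_form:
  assumes "i \<in> I" "x \<in> chart_ran (F i)"
  shows "dbar m I F (function_form I F g) i x =
    (\<lambda>R. \<Sum>a<m. wirtinger_bar a (\<lambda>u. g (chart_par (F i) u)) (chart_coords (F i) x) * covec (m + a) R)"
proof
  fix R
  have "wirtinger_bar a (\<lambda>u. function_form I F g i (chart_par (F i) u) S) (chart_coords (F i) x)
      = wirtinger_bar a (\<lambda>u. g (chart_par (F i) u)) (chart_coords (F i) x) * ext_one S"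
    if "a < m" for a S
  proof -
    have "wirtinger_bar a (\<lambda>u. function_form I F g i (chart_par (F i) u) S) (chart_coords (F i) x)
        = wirtinger_bar a (\<lambda>u. g (chart_par (F i) u) * ext_one S) (chart_coords (F i) x)"
      by (rule wirtinger_bar_cong[OF adapted_open adapted_coords(1)])
        (use assms that in \<open>auto simp: function_form_def chart_ran_def\<close>)
    then show ?thesis
      by (simp add: ext_one_def wirtinger_bar_const)
  qed
  then have "wedge (covec (m + a)) (\<lambda>S. wirtinger_bar a
        (\<lambda>u. function_form I F g i (chart_par (F i) u) S) (chart_coords (F i) x)) R
      = wirtinger_bar a (\<lambda>u. g (chart_par (F i) u)) (chart_coords (F i) x) * covec (m + a) R"
    if "a < m" for a
    by (simp only: that wedge_scale_right wedge_covec_one)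
  then show "dbar m I F (function_form I F g) i x R =
      (\<Sum>a<m. wirtinger_bar a (\<lambda>u. g (chart_par (F i) u)) (chart_coords (F i) x) * covec (m + a) R)"
    unfolding dbar_def using assms by (auto intro: sum.cong)
qed

text \<open>In this form the product of the (0,1)-form dbar g with a form is a combination of the
  products with generators that occur in dbar, so that the Leibniz rules below reduce to those
  for the coefficients.\<close>

lemma dbar_function_form_wedge:
  assumes "i \<in> I" "x \<in> chart_ran (F i)"
  shows "wedge (dbar m I F (function_form I F g) i x) \<beta> R =
    (\<Sum>a<m. wirtinger_bar a (\<lambda>u. g (chart_par (F i) u)) (chart_coords (F i) x)
        * wedge (covec (m + a)) \<beta> R)"
  unfolding dbar_function_form[OF assms] wedge_sum_left wedge_scale_left ..

lemma dbar_scale_form: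
  assumes "smooth_adapted g" "\<omega> \<in> foliated_forms m n I F p q" and ix: "i \<in> I" "x \<in> chart_ran (F i)"
  shows "dbar m I F (scale_form g \<omega>) i x R =
    g x * dbar m I F \<omega> i x R + wedge (dbar m I F (function_form I F g) i x) (\<omega> i x) R"
proof -
  have "wirtinger_bar a (\<lambda>u. scale_form g \<omega> i (chart_par (F i) u) S) (chart_coords (F i) x) =
      g x * wirtinger_bar a (\<lambda>u. \<omega> i (chart_par (F i) u) S) (chart_coords (F i) x)
      + wirtinger_bar a (\<lambda>u. g (chart_par (F i) u)) (chart_coords (F i) x) * \<omega> i x S"
    if "a < m" for a S
    unfolding scale_form_def
    by (subst wirtinger_bar_mult[OF _ _ adapted_coords(1)[OF ix] that])
      (use assms in \<open>auto simp: adapted_coords(2)[OF ix] dest: forms_smooth\<close>)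
  then show ?thesis
    using ix
    by (simp add: dbar_def[of m I F "scale_form g \<omega>"] dbar_def[of m I F \<omega>] dbar_function_form_wedge[OF ix]
        wedge_add_right wedge_scale_right sum.distrib sum_distrib_left)
qed

lemma dbar_function_mult:
  assumes "smooth_adapted f" "smooth_adapted g" and ix: "i \<in> I" "x \<in> chart_ran (F i)"
  shows "wedge (dbar m I F (function_form I F (\<lambda>x. f x * g x)) i x) \<beta> R =
    f x * wedge (dbar m I F (function_form I F g) i x) \<beta> R
    + g x * wedge (dbar m I F (function_form I F f) i x) \<beta> R"
proof -
  have "wirtinger_bar a (\<lambda>u. f (chart_par (F i) u) * g (chart_par (F i) u)) (chart_coords (F i) x)
      = f x * wirtinger_bar a (\<lambda>u. g (chart_par (F i) u)) (chart_coords (F i) x)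
      + g x * wirtinger_bar a (\<lambda>u. f (chart_par (F i) u)) (chart_coords (F i) x)" if "a < m" for a
    by (subst wirtinger_bar_mult[OF _ _ adapted_coords(1)[OF ix] that])
      (use assms in \<open>auto simp: adapted_coords(2)[OF ix]\<close>)
  then show ?thesis
    unfolding dbar_function_form_wedge[OF ix] sum_distrib_left sum.distrib[symmetric]
    by (intro sum.cong) (simp_all add: algebra_simps)
qed

lemma dbar_function_power:
  assumes "smooth_adapted g" and ix: "i \<in> I" "x \<in> chart_ran (F i)"
  shows "g x * wedge (dbar m I F (function_form I F (\<lambda>x. g x ^ k)) i x) \<beta> R =
    of_nat k * g x ^ k * wedge (dbar m I F (function_form I F g) i x) \<beta> R"
proof -
  have "g x * wirtinger_bar a (\<lambda>u. g (chart_par (F i) u) ^ k) (chart_coords (F i) x)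
      = of_nat k * g x ^ k * wirtinger_bar a (\<lambda>u. g (chart_par (F i) u)) (chart_coords (F i) x)"
    if "a < m" for a
    using wirtinger_bar_power[OF adapted_open[OF ix(1)] _ adapted_coords(1)[OF ix] that,
        of "\<lambda>u. g (chart_par (F i) u)" k] assms
    by (simp add: adapted_coords(2)[OF ix])
  then show ?thesis
    unfolding dbar_function_form_wedge[OF ix] sum_distrib_left mult.assoc[symmetric]
    by (intro sum.cong) simp_all
qed

text \<open>The differential of h enters once through the power of h in front of the form and once
  through the twist by f h; the weight p + q in the twist is what makes the two cancel.\<close>

lemma dbar_twisted_intertwines:
  assumes f: "smooth_adapted f" and h: "smooth_adapted h" and \<omega>: "\<omega> \<in> foliated_forms m n I F p q"
  shows "dbar_twisted m I F (\<lambda>x. f x * h x) p q (scale_form (\<lambda>x. h x ^ (p + q)) \<omega>) =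
    scale_form (\<lambda>x. h x ^ Suc (p + q)) (dbar_twisted m I F f p q \<omega>)"
proof (intro ext)
  fix i x R
  define k where "k = p + q"
  show "dbar_twisted m I F (\<lambda>x. f x * h x) p q (scale_form (\<lambda>x. h x ^ (p + q)) \<omega>) i x R =
    scale_form (\<lambda>x. h x ^ Suc (p + q)) (dbar_twisted m I F f p q \<omega>) i x R"
  proof (cases "i \<in> I \<and> x \<in> chart_ran (F i)")
    case False
    then show ?thesis
      by (simp add: scale_form_def dbar_twisted_vanishes_off_charts)
  next
    case True
    then have ix: "i \<in> I" "x \<in> chart_ran (F i)" by auto
    let ?D = "dbar m I F \<omega> i x R"
    let ?dw = "\<lambda>g. wedge (dbar m I F (function_form I F g) i x) (\<omega> i x) R"
    have scaled: "wedge \<alpha> (scale_form (\<lambda>x. h x ^ k) \<omega> i x) R = h x ^ k * wedge \<alpha> (\<omega> i x) R" for \<alpha>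
      by (simp add: scale_form_def wedge_scale_right)
    have "dbar_twisted m I F (\<lambda>x. f x * h x) p q (scale_form (\<lambda>x. h x ^ k) \<omega>) i x R
        = f x * h x * (h x ^ k * ?D + ?dw (\<lambda>x. h x ^ k))
          - of_nat k * (h x ^ k * (f x * ?dw h + h x * ?dw f))"
      using dbar_scale_form[OF smooth_adapted_power[OF h, of k] \<omega> ix, of R]
        dbar_function_mult[OF f h ix, of "\<omega> i x" R]
      by (simp add: dbar_twisted_def scaled k_def[symmetric])
    \<comment> \<open>The factor h is moved to the differential of its power, where the power rule needs it.\<close>
    also have "\<dots> = f x * h x ^ Suc k * ?D + f x * (h x * ?dw (\<lambda>x. h x ^ k))
          - of_nat k * h x ^ k * (f x * ?dw h + h x * ?dw f)"
      by (simp add: algebra_simps)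
    also have "\<dots> = h x ^ Suc k * (f x * ?D - of_nat k * ?dw f)"
      unfolding dbar_function_power[OF h ix] by (simp add: algebra_simps)
    finally show ?thesis
      by (simp add: scale_form_def dbar_twisted_def k_def)
  qed
qed

lemma scale_form_cocycles:
  assumes f: "smooth_adapted f" and h: "smooth_adapted h" and nz: "\<And>x. x \<in> topspace X \<Longrightarrow> h x \<noteq> 0"
  shows "scale_form (\<lambda>x. h x ^ (p + q)) ` cocycles m n I F f p q
    = cocycles m n I F (\<lambda>x. f x * h x) p q"
proof -
  let ?T = "scale_form (\<lambda>x. h x ^ (p + q))" and ?\<Omega> = "foliated_forms m n I F p q"
  have "dbar_twisted m I F (\<lambda>x. f x * h x) p q (?T \<omega>) = (\<lambda>i x S. 0) \<longleftrightarrow>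
      dbar_twisted m I F f p q \<omega> = (\<lambda>i x S. 0)" if "\<omega> \<in> ?\<Omega>" for \<omega>
  proof -
    have "h x ^ Suc (p + q) * dbar_twisted m I F f p q \<omega> i x S = 0 \<longleftrightarrow>
        dbar_twisted m I F f p q \<omega> i x S = 0" for i x S
      using nz[of x] chart_ran_subset[of i] dbar_twisted_vanishes_off_charts[of i x f p q \<omega> S]
      by (cases "i \<in> I \<and> x \<in> chart_ran (F i)") auto
    then show ?thesis
      unfolding dbar_twisted_intertwines[OF f h that] unfolding scale_form_def fun_eq_iff by blast
  qed
  then have "cocycles m n I F (\<lambda>x. f x * h x) p q \<inter> ?T ` ?\<Omega> = ?T ` cocycles m n I F f p q"
    using scale_form_in_forms[OF smooth_adapted_power[OF h]] by (auto simp: cocycles_def)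
  moreover have "?T ` ?\<Omega> = ?\<Omega>"
    using nz by (intro scale_form_image smooth_adapted_power h) auto
  moreover have "cocycles m n I F (\<lambda>x. f x * h x) p q \<subseteq> ?\<Omega>"
    by (auto simp: cocycles_def)
  ultimately show ?thesis by blast
qed

lemma scale_form_coboundaries:
  assumes f: "smooth_adapted f" and h: "smooth_adapted h" and nz: "\<And>x. x \<in> topspace X \<Longrightarrow> h x \<noteq> 0"
  shows "scale_form (\<lambda>x. h x ^ (p + q)) ` coboundaries m n I F f p q
    = coboundaries m n I F (\<lambda>x. f x * h x) p q"
proof (cases q)
  case 0
  then show ?thesis by (simp add: coboundaries_def scale_form_def)
next
  case (Suc q')
  let ?\<Omega> = "foliated_forms m n I F p q'"
  have "scale_form (\<lambda>x. h x ^ Suc (p + q')) ` dbar_twisted m I F f p q' ` ?\<Omega>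
      = dbar_twisted m I F (\<lambda>x. f x * h x) p q' ` scale_form (\<lambda>x. h x ^ (p + q')) ` ?\<Omega>"
    unfolding image_image by (rule image_cong) (simp_all add: dbar_twisted_intertwines[OF f h])
  also have "scale_form (\<lambda>x. h x ^ (p + q')) ` ?\<Omega> = ?\<Omega>"
    using nz by (intro scale_form_image smooth_adapted_power h) auto
  finally show ?thesis by (simp add: coboundaries_def Suc)
qed

end


section \<open>Induced isomorphisms of quotients\<close>

text \<open>An additive T maps cosets to cosets, so taking images under T is the induced map on the
  quotients. It is injective as soon as T is injective on the union of the cosets, which V is to
  contain.\<close>

lemma isomorphic_quotient_modules:
  fixes M :: "(complex, 'v) module" and M' :: "(complex, 'w) module"
  assumes add: "\<And>u v. T (u \<oplus>\<^bsub>M\<^esub> v) = T u \<oplus>\<^bsub>M'\<^esub> T v"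
    and smult: "\<And>c v. T (c \<odot>\<^bsub>M\<^esub> v) = c \<odot>\<^bsub>M'\<^esub> T v"
    and carrier: "T ` carrier M = carrier M'"
    and sub: "T ` N = N'"
    and inj: "inj_on T V"
    and V: "\<And>u v. u \<in> N \<Longrightarrow> v \<in> carrier M \<Longrightarrow> u \<oplus>\<^bsub>M\<^esub> v \<in> V"
  shows "isomorphic_complex_spaces (quotient_module M N) (quotient_module M' N')"
proof -
  have coset: "T ` (N +>\<^bsub>M\<^esub> v) = N' +>\<^bsub>M'\<^esub> T v" for v
    unfolding sub[symmetric] a_r_coset_def' by (simp add: image_UN add)
  have cosets: "a_rcosets\<^bsub>M\<^esub> N = (\<lambda>v. N +>\<^bsub>M\<^esub> v) ` carrier M"
    "a_rcosets\<^bsub>M'\<^esub> N' = (\<lambda>v. N' +>\<^bsub>M'\<^esub> v) ` carrier M'"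
    by (auto simp: A_RCOSETS_def RCOSETS_def a_r_coset_def)
  have "(`) T ` (a_rcosets\<^bsub>M\<^esub> N) = a_rcosets\<^bsub>M'\<^esub> N'"
    unfolding cosets carrier[symmetric] by (simp add: image_image coset)
  moreover have "C \<subseteq> V" if "C \<in> a_rcosets\<^bsub>M\<^esub> N" for C
    using that V by (auto simp: cosets a_r_coset_def')
  then have "inj_on ((`) T) (a_rcosets\<^bsub>M\<^esub> N)"
    by (intro inj_onI) (simp add: inj_on_image_eq_iff[OF inj])
  ultimately have "bij_betw ((`) T) (carrier (quotient_module M N)) (carrier (quotient_module M' N'))"
    by (simp add: bij_betw_def quotient_module_def)
  moreover have "T ` (C <+>\<^bsub>M\<^esub> D) = T ` C <+>\<^bsub>M'\<^esub> T ` D" for C D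
    by (simp add: set_add_def' image_UN add)
  moreover have "T ` (\<Union>v\<in>C. N +>\<^bsub>M\<^esub> (c \<odot>\<^bsub>M\<^esub> v)) = (\<Union>v\<in>T ` C. N' +>\<^bsub>M'\<^esub> (c \<odot>\<^bsub>M'\<^esub> v))" for c C
    by (simp add: image_UN coset smult)
  ultimately show ?thesis
    unfolding isomorphic_complex_spaces_def
    by (intro exI[of _ "(`) T"]) (simp add: quotient_module_def)
qed

theorem proposition2p3:
  fixes X :: "'a topology" and m n :: nat and Atl :: "'a chart set"
    and I :: "'i set" and F :: "'i \<Rightarrow> 'a chart"
    and f h :: "'a \<Rightarrow> complex"
  assumes "complex_foliation X m n Atl I F"
    and "smooth_function m n Atl f"
    and "smooth_function m n Atl h"
    and "\<forall>x\<in>topspace X. h x \<noteq> 0"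
  shows "\<forall>p q. isomorphic_complex_spaces
           (foliated_cohomology m n I F f p q)
           (foliated_cohomology m n I F (\<lambda>x. f x * h x) p q)"
proof (intro allI)
  fix p q
  interpret complex_foliation X m n Atl I F by (rule assms(1))
  have f: "smooth_adapted f" and h: "smooth_adapted h"
    using assms(2,3) by (auto dest: smooth_adapted_of_smooth_function)
  have nz: "\<And>x. x \<in> topspace X \<Longrightarrow> h x \<noteq> 0"
    using assms(4) by blast
  let ?T = "scale_form (\<lambda>x. h x ^ (p + q)) :: ('i, 'a) form \<Rightarrow> _"
  \<comment> \<open>Multiplication by the power of h need not be injective on arbitrary families, as h may vanish
    off the manifold; it is injective on the families that vanish off the charts.\<close>
  let ?V = "{\<omega> :: ('i, 'a) form. \<forall>i x S. \<not> (i \<in> I \<and> x \<in> chart_ran (F i)) \<longrightarrow> \<omega> i x S = 0}"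
  have inj: "inj_on ?T ?V"
    by (rule inj_on_inverseI[where g = "scale_form (\<lambda>x. inverse (h x ^ (p + q)))"])
      (rule scale_form_inverse(2); use nz in auto)
  have cocycles_V: "cocycles m n I F f p q \<subseteq> ?V"
    using forms_vanish_off_charts unfolding cocycles_def by blast
  have coboundaries_V: "coboundaries m n I F f p q \<subseteq> ?V"
    by (cases q) (auto simp: coboundaries_def dbar_twisted_vanishes_off_charts)
  show "isomorphic_complex_spaces (foliated_cohomology m n I F f p q)
      (foliated_cohomology m n I F (\<lambda>x. f x * h x) p q)"
    unfolding foliated_cohomology_def
  proof (rule isomorphic_quotient_modules[where T = ?T and V = ?V])
    show "inj_on ?T ?V" by (rule inj)
  next
    fix u v assume "u \<in> coboundaries m n I F f p q"
      "v \<in> carrier (cocycle_module m n I F f p q)"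
    then have "u \<in> ?V" "v \<in> ?V"
      using cocycles_V coboundaries_V by (auto simp: cocycle_module_def)
    then show "u \<oplus>\<^bsub>cocycle_module m n I F f p q\<^esub> v \<in> ?V"
      by (simp add: cocycle_module_def)
  qed (simp_all add: cocycle_module_def scale_form_cocycles[OF f h nz]
      scale_form_coboundaries[OF f h nz], simp_all add: scale_form_def algebra_simps)
qed

end
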